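(* Let $k>1$ be a real number and let $a,b,h>0$ be real numbers. Consider in the $(X,Y)$-plane the Lamé arc $$\left(\frac{X}{b}\right)^k+\left(1-\frac{Y}{h}\right)^k=1,\qquad 0\le X\le b,\quad 0\le Y\le h,$$ and let $C=(0,h)$ and $A=(a,0)$. Then the segment $AC$ meets the arc in a single point $P=(X,Y)$, and its abscissa is $$X=\frac{ab}{(a^k+b^k)^{1/k}}.$$ Thus $X$ is independent of $h$, and $c=X$ satisfies $\dfrac1{c^k}=\dfrac1{a^k}+\dfrac1{b^k}$.
   Context: Powers with real exponent $k$ are powers of nonnegative real numbers (with $0^k=0$). The segment $AC$ is the closed straight line segment joining $A$ and $C$. Geometrically, the perpendicular from $P$ to the horizontal axis cuts off from the origin a segment of length $X$. *)

theory Defs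
  imports "HOL-Analysis.Analysis"
begin

text \<open>
  The bounds on \<open>X\<close> and \<open>Y\<close> make both bases nonnegative, and
  \<open>0 powr k = 0\<close>, so \<^term>\<open>(powr)\<close> is the intended real power on all of the arc.
\<close>

definition lame_arc :: "real \<Rightarrow> real \<Rightarrow> real \<Rightarrow> (real \<times> real) set" where
  "lame_arc k b h =
    {(X, Y). 0 \<le> X \<and> X \<le> b \<and> 0 \<le> Y \<and> Y \<le> h \<and>
             (X / b) powr k + (1 - Y / h) powr k = 1}"

end

theory Submission
  imports Defs
begin

text \<open>
  Along the segment from \<open>(a, 0)\<close> to \<open>(0, h)\<close> one has \<open>1 - Y / h = X / a\<close> (intercept theorem).
  Substituting this into the equation of the arc removes both \<open>Y\<close> and \<open>h\<close> and leaves
  \<open>(X / b) powr k + (X / a) powr k = 1\<close>. With \<open>c\<close> defined by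
  \<open>1 / c powr k = 1 / a powr k + 1 / b powr k\<close>, the left side is \<open>(X / c) powr k\<close>, which on
  \<open>X \<ge> 0\<close> takes the value \<open>1\<close> only at \<open>X = c\<close>. The relation also forces \<open>c \<le> a\<close> and
  \<open>c \<le> b\<close>, so this root does lie on the segment and within the bounds of the arc.
\<close>

text \<open>
  Up to the factor \<open>2 powr (1 / k)\<close> this is the power mean of \<open>a\<close> and \<open>b\<close> with exponent \<open>- k\<close>.
\<close>
definition power_harmonic :: "real \<Rightarrow> real \<Rightarrow> real \<Rightarrow> real" where
  "power_harmonic k a b = a * b / (a powr k + b powr k) powr (1 / k)"

lemma power_harmonic_pos:
  assumes "a > 0" "b > 0"
  shows "power_harmonic k a b > 0"
proof -
  have "a powr k + b powr k > 0"
    using assms by (simp add: add_pos_pos)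
  then show ?thesis
    using assms by (simp add: power_harmonic_def)
qed

lemma power_harmonic_relation:
  assumes "k > 0" "a > 0" "b > 0"
  shows "1 / power_harmonic k a b powr k = 1 / a powr k + 1 / b powr k"
proof -
  have pos: "a powr k > 0" "b powr k > 0"
    using assms by simp_all
  then have "power_harmonic k a b powr k = a powr k * b powr k / (a powr k + b powr k)"
    using assms by (simp add: power_harmonic_def powr_divide powr_mult powr_powr)
  then show ?thesis
    using pos by (simp add: add_divide_distrib)
qed

lemma power_harmonic_commute: "power_harmonic k a b = power_harmonic k b a"
  by (simp add: power_harmonic_def ac_simps)

lemma power_harmonic_le:
  assumes "k > 0" "a > 0" "b > 0"
  shows "power_harmonic k a b \<le> a"
proof -
  have "1 / a powr k \<le> 1 / power_harmonic k a b powr k"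
    using power_harmonic_relation[OF assms] by simp
  then have "power_harmonic k a b powr k \<le> a powr k"
    using assms power_harmonic_pos[of a b k] by (simp add: field_simps)
  then show ?thesis
    using assms powr_less_mono2[of k a "power_harmonic k a b"] by linarith
qed

text \<open>
  The sum of powers on the left is \<open>(X / power_harmonic k a b) powr k\<close>; the sign condition makes
  the power injective.
\<close>
lemma powr_sum_eq_1_iff:
  assumes "k > 0" "a > 0" "b > 0" "X \<ge> 0"
  shows "(X / b) powr k + (X / a) powr k = 1 \<longleftrightarrow> X = power_harmonic k a b"
proof -
  let ?c = "power_harmonic k a b"
  have c: "?c > 0"
    using assms power_harmonic_pos by blast
  have "(X / b) powr k + (X / a) powr k = X powr k * (1 / a powr k + 1 / b powr k)"
    using assms by (simp add: powr_divide algebra_simps)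
  also have "\<dots> = (X / ?c) powr k"
    using assms c by (simp add: power_harmonic_relation[symmetric] powr_divide)
  finally have "(X / b) powr k + (X / a) powr k = 1 \<longleftrightarrow> (X / ?c) powr k = 1"
    by simp
  also have "\<dots> \<longleftrightarrow> X / ?c = 1"
  proof
    assume "(X / ?c) powr k = 1"
    then have "((X / ?c) powr k) powr (1 / k) = 1"
      by simp
    then show "X / ?c = 1"
      using assms c by (simp add: powr_powr)
  qed simp
  also have "\<dots> \<longleftrightarrow> X = ?c"
    using c by auto
  finally show ?thesis .
qed

lemma mem_closed_segment_axes_iff:
  fixes a h X Y :: real
  assumes "a > 0"
  shows "(X, Y) \<in> closed_segment (a, 0) (0, h) \<longleftrightarrow> 0 \<le> X \<and> X \<le> a \<and> Y = h * (1 - X / a)"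
proof
  assume "(X, Y) \<in> closed_segment (a, 0) (0, h)"
  then obtain u where "0 \<le> u" "u \<le> 1" "X = (1 - u) * a" "Y = u * h"
    by (auto simp: closed_segment_def)
  then show "0 \<le> X \<and> X \<le> a \<and> Y = h * (1 - X / a)"
    using assms by (auto simp: mult_left_le_one_le)
next
  assume "0 \<le> X \<and> X \<le> a \<and> Y = h * (1 - X / a)"
  then show "(X, Y) \<in> closed_segment (a, 0) (0, h)"
    unfolding closed_segment_def using assms
    by (auto intro!: exI[of _ "1 - X / a"] simp: field_simps)
qed

lemma closed_segment_Int_lame_arc:
  assumes "k > 0" "a > 0" "b > 0" "h > 0"
  defines "c \<equiv> power_harmonic k a b"
  shows "closed_segment (a, 0) (0, h) \<inter> lame_arc k b h = {(c, h * (1 - c / a))}"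
proof -
  have bounds: "0 < c" "c \<le> a" "c \<le> b"
    using assms power_harmonic_pos power_harmonic_le power_harmonic_commute by metis+
  have "(X, Y) \<in> closed_segment (a, 0) (0, h) \<inter> lame_arc k b h \<longleftrightarrow>
      X = c \<and> Y = h * (1 - c / a)" for X Y
  proof (cases "(X, Y) \<in> closed_segment (a, 0) (0, h)")
    case True
    then have X: "0 \<le> X" "X \<le> a" and Y: "Y = h * (1 - X / a)"
      using assms by (auto simp: mem_closed_segment_axes_iff)
    then have "1 - Y / h = X / a" "0 \<le> Y" "Y \<le> h"
      using assms by (auto simp: mult_le_cancel_left1)
    then have "(X, Y) \<in> lame_arc k b h \<longleftrightarrow> X \<le> b \<and> (X / b) powr k + (X / a) powr k = 1"
      using X by (simp add: lame_arc_def)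
    also have "\<dots> \<longleftrightarrow> X = c"
      using assms X bounds by (auto simp: powr_sum_eq_1_iff)
    finally show ?thesis
      using True Y by auto
  next
    case False
    then show ?thesis
      using assms bounds by (auto simp: mem_closed_segment_axes_iff)
  qed
  then show ?thesis
    by auto
qed

theorem mainTheorem3:
  fixes k a b h :: real
  assumes "k > 1" and "a > 0" and "b > 0" and "h > 0"
  shows "\<exists>X Y. closed_segment (a, 0) (0, h) \<inter> lame_arc k b h = {(X, Y)} \<and>
               X = a * b / (a powr k + b powr k) powr (1 / k) \<and>
               (\<forall>h'>0. \<exists>Y'. closed_segment (a, 0) (0, h') \<inter> lame_arc k b h' = {(X, Y')}) \<and>
               1 / X powr k = 1 / a powr k + 1 / b powr k"
proof -
  let ?c = "power_harmonic k a b"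
  have k: "k > 0"
    using assms by simp
  have meet: "closed_segment (a, 0) (0, h') \<inter> lame_arc k b h' = {(?c, h' * (1 - ?c / a))}"
    if "h' > 0" for h'
    using closed_segment_Int_lame_arc[OF k \<open>a > 0\<close> \<open>b > 0\<close> that] .
  have "1 / ?c powr k = 1 / a powr k + 1 / b powr k"
    using power_harmonic_relation[OF k \<open>a > 0\<close> \<open>b > 0\<close>] .
  moreover have "?c = a * b / (a powr k + b powr k) powr (1 / k)"
    by (rule power_harmonic_def)
  ultimately show ?thesis
    using meet \<open>h > 0\<close> by blast
qed

end
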